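(* Let $\mathbf e_i$ be the $i$-th canonical basis vector of $\mathbb R^d$ for $1\le i\le d$ and let $\mathbf e_{d+1}=(-1,\ldots,-1)\in\mathbb R^d$. Let $\Gamma$ be a pure $d$-dimensional simplicial complex in $\mathbb R^d$ supported on a finite set $\mathcal A=\{\mathbf a_1,\dots,\mathbf a_{n}\}\subset\mathbb R^d$, $n=|\mathcal A|$. If $\Gamma$ is balanced and $\gamma:\mathcal A\to\{1,\ldots,d+1\}$ is a $(d+1)$-coloring of $\Gamma$, then the $d\times n$ matrix $C$ with columns $\mathbf e_{\gamma(\mathbf a_1)},\ldots,\mathbf e_{\gamma(\mathbf a_{n})}$ positively decorates $\Gamma$.
   Context: Supported on $\mathcal A$ means that the vertices of $\Gamma$ belong to $\mathcal A$. A $(d+1)$-coloring of $\Gamma$ is a map $\gamma:\mathcal A\to\{1,\ldots,d+1\}$ such that $\gamma(\mathbf a)\neq\gamma(\mathbf a')$ for any edge $\{\mathbf a,\mathbf a'\}$ of $\Gamma$; $\Gamma$ is balanced if such a coloring exists. A real $d\times(d+1)$ matrix $M$ is oriented if the values $(-1)^i\operatorname{minor}(M,i)$, $i=1,\dots,d+1$, are all nonzero and have the same sign, where $\operatorname{minor}(M,i)$ is the determinant of the matrix obtained by removing the $i$-th column of $M$. A $d\times n$ matrix $C$ positively decorates $\Gamma$ if for every $d$-simplex of $\Gamma$ the $d\times(d+1)$ submatrix of $C$ whose columns correspond to the vertices of this simplex is oriented. *)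

theory Defs
  imports
    "HOL-Analysis.Analysis"
    "Jordan_Normal_Form.Determinant"
    "Jordan_Normal_Form.DL_Submatrix"
begin

text \<open>
  Points of the supporting configuration live in \<open>real ^ 'd\<close>, with \<open>d = CARD('d)\<close>.
  Coefficient matrices are Jordan-Normal-Form matrices with \<open>d\<close> rows, since they need ordered
  rows and columns and non-square shapes.
  Columns are indexed from \<open>0\<close>, as are the points \<open>a 0, ..., a (n - 1)\<close>; colours, basis
  vectors and minors keep the mathematical numbering \<open>1, ..., d + 1\<close>.
\<close>

hide_const (open) Determinants.det Finite_Cartesian_Product.mat
  Finite_Cartesian_Product.vec

unbundle no vec_syntax

definition simplex_vertices :: "(real ^ 'd) set \<Rightarrow> (real ^ 'd) set" where
  "simplex_vertices S = {v. v extreme_point_of S}"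

text \<open>
  The library's \<^const>\<open>simplicial_complex\<close> is a finite geometric complex that may contain
  the empty simplex. Nonemptiness excludes the complex without any simplex, for which the
  condition on maximal simplices is vacuous.
\<close>

definition pure_complex :: "nat \<Rightarrow> (real ^ 'd) set set \<Rightarrow> bool" where
  "pure_complex k \<Gamma> \<longleftrightarrow>
     simplicial_complex \<Gamma> \<and> \<Gamma> \<noteq> {} \<and>
     (\<forall>S\<in>\<Gamma>. (\<forall>T\<in>\<Gamma>. S \<subseteq> T \<longrightarrow> S = T) \<longrightarrow> int k simplex S)"

definition supported_on :: "(real ^ 'd) set set \<Rightarrow> (real ^ 'd) set \<Rightarrow> bool" where
  "supported_on \<Gamma> A \<longleftrightarrow> (\<forall>S\<in>\<Gamma>. simplex_vertices S \<subseteq> A)"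

definition complex_edges :: "(real ^ 'd) set set \<Rightarrow> (real ^ 'd) set set" where
  "complex_edges \<Gamma> = {{u, v} | u v. u \<noteq> v \<and> convex hull {u, v} \<in> \<Gamma>}"

definition is_coloring ::
    "nat \<Rightarrow> (real ^ 'd) set \<Rightarrow> (real ^ 'd) set set \<Rightarrow> (real ^ 'd \<Rightarrow> nat) \<Rightarrow> bool" where
  "is_coloring k A \<Gamma> \<gamma> \<longleftrightarrow>
     \<gamma> ` A \<subseteq> {1..k} \<and> (\<forall>u v. {u, v} \<in> complex_edges \<Gamma> \<longrightarrow> \<gamma> u \<noteq> \<gamma> v)"

definition balanced :: "(real ^ 'd) set \<Rightarrow> (real ^ 'd) set set \<Rightarrow> bool" where
  "balanced A \<Gamma> \<longleftrightarrow> (\<exists>\<gamma>. is_coloring (CARD('d) + 1) A \<Gamma> \<gamma>)"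

text \<open>\<open>delete_col\<close> takes a 0-based column index, \<open>minor\<close> a 1-based one.\<close>

definition delete_col :: "real mat \<Rightarrow> nat \<Rightarrow> real mat" where
  "delete_col M k =
     mat (dim_row M) (dim_col M - 1) (\<lambda>(r, c). M $$ (r, if c < k then c else Suc c))"

definition minor :: "real mat \<Rightarrow> nat \<Rightarrow> real" where
  "minor M i = det (delete_col M (i - 1))"

definition oriented :: "real mat \<Rightarrow> bool" where
  "oriented M \<longleftrightarrow>
     dim_col M = dim_row M + 1 \<and>
     (\<forall>i\<in>{1..dim_col M}. (-1) ^ i * minor M i \<noteq> 0) \<and>
     (\<forall>i\<in>{1..dim_col M}. \<forall>j\<in>{1..dim_col M}.
        sgn ((-1) ^ i * minor M i) = sgn ((-1) ^ j * minor M j))"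

text \<open>
  Column \<open>j\<close> of \<open>C\<close> corresponds to the point \<open>a j\<close>. The selected columns are kept in
  increasing index order.
\<close>

definition positively_decorates ::
    "real mat \<Rightarrow> (nat \<Rightarrow> real ^ 'd) \<Rightarrow> nat \<Rightarrow> (real ^ 'd) set set \<Rightarrow> bool" where
  "positively_decorates C a n \<Gamma> \<longleftrightarrow>
     C \<in> carrier_mat CARD('d) n \<and>
     (\<forall>S\<in>\<Gamma>. int CARD('d) simplex S \<longrightarrow>
        oriented (submatrix C UNIV {j. j < n \<and> a j \<in> simplex_vertices S}))"

definition basis_or_neg_ones :: "nat \<Rightarrow> nat \<Rightarrow> real vec" where
  "basis_or_neg_ones d i = (if i = d + 1 then vec d (\<lambda>_. -1) else unit_vec d (i - 1))"

end

theory Submission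
  imports Defs
begin

text \<open>
  Two facts about the \<open>d + 1\<close> vectors \<open>e\<^sub>1, \<dots>, e\<^sub>d, (-1, \<dots>, -1)\<close>, arranged in any order as the
  columns of a matrix \<open>M\<close>, carry the proof.  Every linear relation between the columns has equal
  coefficients, because row \<open>r\<close> of \<open>M\<close> contains one \<open>1\<close> (at the column \<open>e\<^sub>r\<close>), one \<open>-1\<close>
  (at the column of minus ones) and zeros elsewhere.  And the vector of signed maximal minors of any
  \<open>d \<times> (d + 1)\<close> matrix is such a relation (lemma \<open>signed_minors_in_kernel\<close>).  Hence all signed
  minors of \<open>M\<close> coincide.  They are nonzero because removing the column of minus ones leaves a
  permutation matrix, so \<open>M\<close> is oriented (lemma \<open>oriented_basis_arrangement\<close>), and no sign of a
  permutation has to be followed.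

  It remains to see that each \<open>d\<close>-simplex selects every colour exactly once
  (lemma \<open>coloring_bij_on_simplex\<close>): any two of its \<open>d + 1\<close> vertices span a face, hence an edge of
  the complex, so their colours differ, and there are only \<open>d + 1\<close> colours.
\<close>

section \<open>Signed maximal minors\<close>

text \<open>
  The sum is the Laplace expansion, along its first row, of the square matrix obtained from \<open>M\<close> by
  putting a second copy of row \<open>r\<close> on top.
\<close>

lemma signed_minors_in_kernel:
  assumes M: "M \<in> carrier_mat d (Suc d)" and r: "r < d"
  shows "(\<Sum>c<Suc d. M $$ (r, c) * ((-1) ^ c * det (delete_col M c))) = 0"
proof -
  define N where "N = mat (Suc d) (Suc d) (\<lambda>(i, c). M $$ (if i = 0 then r else i - 1, c))"
  have N: "N \<in> carrier_mat (Suc d) (Suc d)"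
    by (simp add: N_def)
  have "row N 0 = row N (Suc r)"
    using r by (intro eq_vecI) (auto simp: N_def)
  then have "det N = 0"
    using det_identical_rows[OF N, of 0 "Suc r"] r by simp
  moreover have "det N = (\<Sum>c<Suc d. N $$ (0, c) * cofactor N 0 c)"
    by (rule laplace_expansion_row[OF N]) simp
  moreover have "N $$ (0, c) * cofactor N 0 c = M $$ (r, c) * ((-1) ^ c * det (delete_col M c))"
    if "c < Suc d" for c
  proof -
    have "mat_delete N 0 c = delete_col M c"
      using M that by (intro eq_matI) (auto simp: mat_delete_def delete_col_def N_def)
    then show ?thesis
      using that by (simp add: cofactor_def N_def)
  qed
  ultimately show ?thesis
    by simp
qed

lemma orientedI:
  assumes "M \<in> carrier_mat d (Suc d)" and "w \<noteq> 0"
    and "\<And>c. c < Suc d \<Longrightarrow> (-1) ^ c * det (delete_col M c) = w"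
  shows "oriented M"
proof -
  have "(-1) ^ i * minor M i = - w" if "i \<in> {1..Suc d}" for i
  proof -
    have "i = Suc (i - 1)" "i - 1 < Suc d"
      using that by auto
    then obtain c where "i = Suc c" "c < Suc d"
      by blast
    then show ?thesis
      using assms(3)[of c] by (simp add: minor_def)
  qed
  then show ?thesis
    using assms(1,2) by (simp add: oriented_def)
qed

text \<open>
  A matrix whose columns are distinct standard basis vectors is a permutation matrix, and a
  permutation matrix is orthogonal, so its determinant squares to \<open>1\<close>.
\<close>

lemma det_distinct_unit_columns_nonzero:
  fixes P :: "real mat"
  assumes P: "P \<in> carrier_mat d d"
    and entry: "\<And>r c. r < d \<Longrightarrow> c < d \<Longrightarrow> P $$ (r, c) = (if r = p c then 1 else 0)"
    and p: "inj_on p {..<d}" "p ` {..<d} \<subseteq> {..<d}"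
  shows "det P \<noteq> 0"
proof -
  have "P\<^sup>T * P = 1\<^sub>m d"
  proof (rule eq_matI)
    fix i j assume "i < dim_row (1\<^sub>m d)" "j < dim_col (1\<^sub>m d)"
    then have ij: "i < d" "j < d" by simp_all
    then have pi: "p i < d" using p(2) by auto
    have "(P\<^sup>T * P) $$ (i, j) = (\<Sum>r<d. P $$ (r, i) * P $$ (r, j))"
      using ij P by (simp add: scalar_prod_def lessThan_atLeast0)
    also have "\<dots> = (\<Sum>r<d. if r = p i then (if r = p j then 1 else 0) else 0)"
      using ij by (intro sum.cong) (auto simp: entry)
    also have "\<dots> = (if p i = p j then 1 else 0)"
      using pi by (simp add: sum.delta)
    also have "\<dots> = 1\<^sub>m d $$ (i, j)"
      using ij inj_onD[OF p(1), of i j] by auto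
    finally show "(P\<^sup>T * P) $$ (i, j) = 1\<^sub>m d $$ (i, j)" .
  qed (use P in simp_all)
  then have "det P\<^sup>T * det P = 1"
    using P det_mult[of "P\<^sup>T" d P] by simp
  then show ?thesis
    by auto
qed

section \<open>The basis vectors and the vector of minus ones in arbitrary order\<close>

lemma basis_or_neg_ones_index:
  assumes "r < d" and "i \<in> {1..d + 1}"
  shows "basis_or_neg_ones d i $ r = (if i = d + 1 then -1 else if i = r + 1 then 1 else 0)"
  using assms by (auto simp: basis_or_neg_ones_def unit_vec_def)

lemma oriented_basis_arrangement:
  assumes M: "M \<in> carrier_mat d (Suc d)"
    and entry: "\<And>r c. r < d \<Longrightarrow> c < Suc d \<Longrightarrow> M $$ (r, c) = basis_or_neg_ones d (\<sigma> c) $ r"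
    and \<sigma>: "bij_betw \<sigma> {..<Suc d} {1..d + 1}"
  shows "oriented M"
proof -
  define w where "w c = (-1) ^ c * det (delete_col M c)" for c
  have \<sigma>_inj: "\<sigma> c = \<sigma> c' \<longleftrightarrow> c = c'" if "c < Suc d" "c' < Suc d" for c c'
    using \<sigma> that by (auto simp: bij_betw_def inj_on_def)
  have \<sigma>_range: "\<sigma> c \<in> {1..d + 1}" if "c < Suc d" for c
    using bij_betwE[OF \<sigma>] that by blast
  have "d + 1 \<in> \<sigma> ` {..<Suc d}"
    unfolding bij_betw_imp_surj_on[OF \<sigma>] by simp
  then obtain k where k: "k < Suc d" "\<sigma> k = d + 1"
    by auto
  have entry': "M $$ (r, c) = (if c = k then -1 else if \<sigma> c = r + 1 then 1 else 0)"
    if "r < d" "c < Suc d" for r c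
    using that k \<sigma>_inj[of c k] by (simp add: entry basis_or_neg_ones_index[OF _ \<sigma>_range])
  have w_const: "w c = w k" if c: "c < Suc d" for c
  proof (cases "c = k")
    case False
    define r where "r = \<sigma> c - 1"
    have r: "r < d" "\<sigma> c = r + 1"
      using \<sigma>_range[OF c] \<sigma>_inj[OF c k(1)] False k(2) by (auto simp: r_def)
    \<comment> \<open>Row \<open>r\<close> is the one whose \<open>1\<close> sits in column \<open>c\<close>; it reads off \<open>w c - w k\<close>.\<close>
    have "0 = (\<Sum>x<Suc d. M $$ (r, x) * w x)"
      using signed_minors_in_kernel[OF M r(1)] by (simp add: w_def)
    also have "\<dots> = (\<Sum>x<Suc d. (if x = c then w x else 0) - (if x = k then w x else 0))"
    proof (rule sum.cong)
      fix x assume x: "x \<in> {..<Suc d}"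
      then have "\<sigma> x = r + 1 \<longleftrightarrow> x = c"
        using \<sigma>_inj[of x c] c r(2) by simp
      then show "M $$ (r, x) * w x = (if x = c then w x else 0) - (if x = k then w x else 0)"
        using entry'[OF r(1), of x] x False by auto
    qed simp
    also have "\<dots> = w c - w k"
      using c k(1) by (simp add: sum_subtractf sum.delta del: sum.lessThan_Suc)
    finally show ?thesis
      by simp
  qed simp
  \<comment> \<open>\<open>skip c\<close> is the column of \<open>M\<close> that becomes column \<open>c\<close> once column \<open>k\<close> is removed.\<close>
  define skip where "skip c = (if c < k then c else Suc c)" for c
  have skip: "skip c < Suc d" "skip c \<noteq> k" if "c < d" for c
    using that by (auto simp: skip_def)
  have \<sigma>_skip: "\<sigma> (skip c) \<in> {1..d}" if "c < d" for c
    using \<sigma>_range[OF skip(1)[OF that]] \<sigma>_inj[OF skip(1)[OF that] k(1)] skip(2)[OF that] k(2)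
    by auto
  have "det (delete_col M k) \<noteq> 0"
  proof (rule det_distinct_unit_columns_nonzero)
    show "delete_col M k \<in> carrier_mat d d"
      using M by (simp add: delete_col_def)
  next
    fix r c assume rc: "r < d" "c < d"
    then have "delete_col M k $$ (r, c) = M $$ (r, skip c)"
      using M by (simp add: delete_col_def skip_def)
    then show "delete_col M k $$ (r, c) = (if r = \<sigma> (skip c) - 1 then 1 else 0)"
      using rc entry'[OF rc(1) skip(1)[OF rc(2)]] skip(2)[OF rc(2)] \<sigma>_skip[OF rc(2)] by auto
  next
    show "inj_on (\<lambda>c. \<sigma> (skip c) - 1) {..<d}"
    proof (rule inj_onI)
      fix c c' assume c: "c \<in> {..<d}" "c' \<in> {..<d}" "\<sigma> (skip c) - 1 = \<sigma> (skip c') - 1"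
      then have "\<sigma> (skip c) = \<sigma> (skip c')"
        using \<sigma>_skip[of c] \<sigma>_skip[of c'] by auto
      then have "skip c = skip c'"
        using \<sigma>_inj[of "skip c" "skip c'"] skip(1) c by simp
      then show "c = c'"
        by (auto simp: skip_def split: if_splits)
    qed
  next
    show "(\<lambda>c. \<sigma> (skip c) - 1) ` {..<d} \<subseteq> {..<d}"
      using \<sigma>_skip by fastforce
  qed
  then have "w k \<noteq> 0"
    by (simp add: w_def)
  then show ?thesis
    using orientedI[OF M, of "w k"] w_const by (simp add: w_def)
qed

section \<open>Colours of the vertices of a simplex\<close>

lemma simplex_vertices_convex_hull:
  "\<not> affine_dependent T \<Longrightarrow> simplex_vertices (convex hull T) = T"
  by (simp add: simplex_vertices_def extreme_point_of_convex_hull_affine_independent)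

lemma card_simplex_vertices:
  assumes "int k simplex S"
  shows "card (simplex_vertices S) = k + 1"
proof -
  obtain T where "\<not> affine_dependent T" "int (card T) = int k + 1" "S = convex hull T"
    using assms unfolding simplex_def by blast
  then show ?thesis
    by (simp add: simplex_vertices_convex_hull)
qed

lemma simplex_vertices_edge:
  assumes \<Gamma>: "simplicial_complex \<Gamma>" and S: "S \<in> \<Gamma>"
    and uv: "u \<in> simplex_vertices S" "v \<in> simplex_vertices S" "u \<noteq> v"
  shows "{u, v} \<in> complex_edges \<Gamma>"
proof -
  obtain k where "k simplex S"
    using \<Gamma> S unfolding simplicial_complex_def by blast
  then obtain T where T: "\<not> affine_dependent T" "S = convex hull T"
    unfolding simplex_def by blast
  then have "{u, v} \<subseteq> T"
    using uv by (simp add: simplex_vertices_convex_hull)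
  then have "convex hull {u, v} face_of S"
    unfolding T(2) face_of_convex_hull_affine_independent[OF T(1)] by blast
  then have "convex hull {u, v} \<in> \<Gamma>"
    using \<Gamma> S unfolding simplicial_complex_def by blast
  then show ?thesis
    using uv(3) unfolding complex_edges_def by blast
qed

lemma coloring_bij_on_simplex:
  assumes "simplicial_complex \<Gamma>" and "supported_on \<Gamma> A" and col: "is_coloring (k + 1) A \<Gamma> \<gamma>"
    and S: "S \<in> \<Gamma>" "int k simplex S"
  shows "bij_betw \<gamma> (simplex_vertices S) {1..k + 1}"
proof -
  have inj: "inj_on \<gamma> (simplex_vertices S)"
    using simplex_vertices_edge[OF assms(1) S(1)] col unfolding is_coloring_def inj_on_def by blast
  have "\<gamma> ` simplex_vertices S \<subseteq> {1..k + 1}"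
    using assms(2) col S(1) unfolding supported_on_def is_coloring_def by blast
  moreover have "card (\<gamma> ` simplex_vertices S) = card {1..k + 1}"
    using card_image[OF inj] card_simplex_vertices[OF S(2)] by simp
  ultimately show ?thesis
    using inj card_subset_eq[of "{1..k + 1}"] unfolding bij_betw_def by simp
qed

section \<open>The decoration\<close>

text \<open>
  Column \<open>k\<close> of the submatrix with column set \<open>J\<close> is column \<open>pick J k\<close> of the full matrix, so this
  bijection transports the colouring of the points to the columns of the submatrix.
\<close>

lemma bij_betw_pick:
  assumes "finite J"
  shows "bij_betw (pick J) {..<card J} J"
proof -
  have inj: "inj_on (pick J) {..<card J}"
  proof (rule inj_onI)
    fix i j assume "i \<in> {..<card J}" "j \<in> {..<card J}" "pick J i = pick J j"
    then show "i = j"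
      using pick_mono_le[of i J j] pick_mono_le[of j J i] by (cases i j rule: linorder_cases) auto
  qed
  moreover have "pick J ` {..<card J} \<subseteq> J"
    using pick_in_set_le by blast
  ultimately show ?thesis
    using assms card_subset_eq[of J "pick J ` {..<card J}"] by (simp add: bij_betw_def card_image)
qed

theorem proposition3p6:
  fixes A :: "(real ^ 'd) set"
    and a :: "nat \<Rightarrow> real ^ 'd"
    and n :: nat
    and \<Gamma> :: "(real ^ 'd) set set"
    and \<gamma> :: "real ^ 'd \<Rightarrow> nat"
  assumes "finite A" and "n = card A" and "bij_betw a {..<n} A"
    and "pure_complex CARD('d) \<Gamma>"
    and "supported_on \<Gamma> A"
    and "balanced A \<Gamma>"
    and "is_coloring (CARD('d) + 1) A \<Gamma> \<gamma>"
  shows "positively_decorates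
           (mat_of_cols CARD('d) (map (\<lambda>j. basis_or_neg_ones CARD('d) (\<gamma> (a j))) [0..<n])) a n \<Gamma>"
proof -
  let ?d = "CARD('d)"
  define C where "C = mat_of_cols ?d (map (\<lambda>j. basis_or_neg_ones ?d (\<gamma> (a j))) [0..<n])"
  have C: "C \<in> carrier_mat ?d n"
    unfolding C_def using mat_of_cols_carrier(1)[of ?d "map _ [0..<n]"] by simp
  have \<Gamma>: "simplicial_complex \<Gamma>"
    using assms(4) by (simp add: pure_complex_def)
  have "oriented (submatrix C UNIV {j. j < n \<and> a j \<in> simplex_vertices S})"
    if S: "S \<in> \<Gamma>" "int ?d simplex S" for S
  proof -
    define J where "J = {j. j < n \<and> a j \<in> simplex_vertices S}"
    have "simplex_vertices S \<subseteq> A"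
      using assms(5) S(1) by (simp add: supported_on_def)
    then have "a ` J = simplex_vertices S"
      using bij_betw_imp_surj_on[OF assms(3)] by (auto simp: J_def)
    moreover have "inj_on a J"
      using assms(3) by (auto simp: J_def bij_betw_def inj_on_def)
    ultimately have aJ: "bij_betw a J (simplex_vertices S)"
      by (simp add: bij_betw_def)
    have cardJ: "card J = Suc ?d"
      using bij_betw_same_card[OF aJ] card_simplex_vertices[OF S(2)] by simp
    have pick: "bij_betw (pick J) {..<Suc ?d} J"
      using bij_betw_pick[of J] cardJ by (simp add: J_def)
    have dims: "{i. i < dim_row C \<and> i \<in> UNIV} = {..<?d}" "{j. j < dim_col C \<and> j \<in> J} = J"
      using C by (auto simp: J_def)
    show ?thesis
      unfolding J_def[symmetric]
    proof (rule oriented_basis_arrangement)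
      show "submatrix C UNIV J \<in> carrier_mat ?d (Suc ?d)"
        unfolding carrier_mat_def mem_Collect_eq dim_submatrix dims cardJ by simp
    next
      fix r c assume rc: "r < ?d" "c < Suc ?d"
      then have "pick J c < n"
        using bij_betwE[OF pick] by (auto simp: J_def)
      then show "submatrix C UNIV J $$ (r, c) = basis_or_neg_ones ?d ((\<gamma> \<circ> (a \<circ> pick J)) c) $ r"
        using rc unfolding submatrix_def dims cardJ pick_UNIV
        by (simp add: C_def mat_of_cols_def)
    next
      show "bij_betw (\<gamma> \<circ> (a \<circ> pick J)) {..<Suc ?d} {1..?d + 1}"
        by (rule bij_betw_trans[OF bij_betw_trans[OF pick aJ]
              coloring_bij_on_simplex[OF \<Gamma> assms(5,7) S]])
    qed
  qed
  then show ?thesis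
    using C unfolding positively_decorates_def C_def by blast
qed

end
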